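(* Let $A_0,A_1,A_2,A_3$ be complex numbers (in the paper's application, rational numbers) satisfying $$A_3\neq 0,\qquad \frac{A_1}{A_3}-\frac{A_2^2}{3A_3^2}\neq 0,\qquad \frac{A_0}{A_3}-\frac{A_1A_2}{3A_3^2}+\frac{2A_2^3}{27A_3^3}\neq 0,$$ and let $x_1,x_2,x_3$ be the three roots (counted with multiplicity) of the cubic equation $A_3x^3+A_2x^2+A_1x+A_0=0$, i.e. $A_3x^3+A_2x^2+A_1x+A_0=A_3(x-x_1)(x-x_2)(x-x_3)$. Put $$D=-\frac{(9A_1A_2A_3-27A_0A_3^2-2A_2^3)^2}{27\,(A_2^2-3A_1A_3)^3}.$$ Then the number $$w=\frac{3(x_1-x_2)}{2x_3-x_1-x_2}$$ is a solution of the sextic equation $$D\,(w^2+3)^3+4\,(w-1)^2(1+w)^2=0,$$ and the roots $x_1,x_2,x_3$ are expressed back through this $w$ by the formulas $$x_1=\frac{(2A_2^3-9A_1A_2A_3+27A_0A_3^2)\,w^2+(18A_1A_2A_3-6A_2^3)\,w-9A_1A_2A_3+81A_0A_3^2}{18\,A_3\,(A_2^2-3A_1A_3)\,(1+w)},$$ $$x_2=\frac{(2A_2^3-9A_1A_2A_3+27A_0A_3^2)\,w^2-(18A_1A_2A_3-6A_2^3)\,w-9A_1A_2A_3+81A_0A_3^2}{18\,A_3\,(A_2^2-3A_1A_3)\,(1-w)},$$ $$x_3=\frac{(A_2^3-27A_0A_3^2)\,w^2+36A_1A_2A_3-81A_0A_3^2-9A_2^3}{9\,A_3\,(A_2^2-3A_1A_3)\,(1-w)(1+w)}.$$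 *)

theory Defs
  imports Complex_Main "HOL-Computational_Algebra.Polynomial"
begin

end

theory Submission
  imports Defs
begin

text \<open>Write \<open>u\<close>, \<open>a\<close>, \<open>b\<close> for the linear forms \<open>3 x\<^sub>i - (x\<^sub>1 + x\<^sub>2 + x\<^sub>3)\<close> with
  \<open>i = 3, 2, 1\<close> (up to sign), \<open>P = A\<^sub>2\<^sup>2 - 3 A\<^sub>1 A\<^sub>3\<close>, and \<open>Q\<close> for \<open>27 A\<^sub>3\<^sup>3\<close> times the constant term
  of the depressed cubic. Then \<open>Q = - A\<^sub>3\<^sup>3 u a b\<close>, so no linear form vanishes, and
  \<open>1 + w = 2 a / u\<close>, \<open>1 - w = 2 b / u\<close>, \<open>A\<^sub>3\<^sup>2 (w\<^sup>2 + 3) u\<^sup>2 = 12 P\<close>. This gives the sextic.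
  The numerators of the root formulas are \<open>Q (w\<^sup>2 + 3) - 6 A\<^sub>2 P (1 \<plusminus> w)\<close> and
  \<open>- Q (w\<^sup>2 + 3) - 3 A\<^sub>2 P (1 - w\<^sup>2)\<close>, which factor completely in \<open>u\<close>, \<open>a\<close>, \<open>b\<close>, \<open>P\<close> and a root.\<close>

text \<open>Vieta by comparing coefficients; unfolding it reduces later claims to polynomial
  identities in \<open>A3\<close> and the roots.\<close>

lemma cubic_coeffs_from_roots:
  fixes A0 A1 A2 A3 x1 x2 x3 :: "'a::comm_ring_1"
  assumes "[:A0, A1, A2, A3:] = smult A3 ([:-x1, 1:] * [:-x2, 1:] * [:-x3, 1:])"
  shows "A2 = - A3 * (x1 + x2 + x3)"
    and "A1 = A3 * (x1 * x2 + x1 * x3 + x2 * x3)"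
    and "A0 = - A3 * (x1 * x2 * x3)"
  using assms by (simp_all add: algebra_simps)

theorem theorem3p1:
  fixes A0 A1 A2 A3 x1 x2 x3 D w :: complex
  assumes "A3 \<noteq> 0"
    and "A1 / A3 - A2^2 / (3 * A3^2) \<noteq> 0"
    and "A0 / A3 - A1 * A2 / (3 * A3^2) + 2 * A2^3 / (27 * A3^3) \<noteq> 0"
    and "[:A0, A1, A2, A3:] = smult A3 ([:-x1, 1:] * [:-x2, 1:] * [:-x3, 1:])"
    and "D = - ((9 * A1 * A2 * A3 - 27 * A0 * A3^2 - 2 * A2^3)^2
              / (27 * (A2^2 - 3 * A1 * A3)^3))"
    and "w = 3 * (x1 - x2) / (2 * x3 - x1 - x2)"
  shows "A2^2 - 3 * A1 * A3 \<noteq> 0 \<and> 2 * x3 - x1 - x2 \<noteq> 0 \<and> 1 + w \<noteq> 0 \<and> 1 - w \<noteq> 0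
    \<and> D * (w^2 + 3)^3 + 4 * (w - 1)^2 * (1 + w)^2 = 0
    \<and> x1 = ((2 * A2^3 - 9 * A1 * A2 * A3 + 27 * A0 * A3^2) * w^2
              + (18 * A1 * A2 * A3 - 6 * A2^3) * w
              - 9 * A1 * A2 * A3 + 81 * A0 * A3^2)
            / (18 * A3 * (A2^2 - 3 * A1 * A3) * (1 + w))
    \<and> x2 = ((2 * A2^3 - 9 * A1 * A2 * A3 + 27 * A0 * A3^2) * w^2
              - (18 * A1 * A2 * A3 - 6 * A2^3) * w
              - 9 * A1 * A2 * A3 + 81 * A0 * A3^2)
            / (18 * A3 * (A2^2 - 3 * A1 * A3) * (1 - w))
    \<and> x3 = ((A2^3 - 27 * A0 * A3^2) * w^2
              + 36 * A1 * A2 * A3 - 81 * A0 * A3^2 - 9 * A2^3)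
            / (9 * A3 * (A2^2 - 3 * A1 * A3) * (1 - w) * (1 + w))"
proof -
  note A = cubic_coeffs_from_roots[OF assms(4)]
  define u a b where "u = 2 * x3 - x1 - x2" and "a = x1 + x3 - 2 * x2" and "b = x3 + x2 - 2 * x1"
  define P where "P = A2^2 - 3 * A1 * A3"
  define Q where "Q = 2 * A2^3 - 9 * A1 * A2 * A3 + 27 * A0 * A3^2"
  \<comment> \<open>This is the linear coefficient of the depressed cubic.\<close>
  have "A1 / A3 - A2^2 / (3 * A3^2) = - P / (3 * A3^2)"
    using assms(1) by (simp add: P_def field_simps power2_eq_square)
  then have P0: "P \<noteq> 0" using assms(2) by auto
  have "A0 / A3 - A1 * A2 / (3 * A3^2) + 2 * A2^3 / (27 * A3^3) = Q / (27 * A3^3)"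
    using assms(1) by (simp add: Q_def field_simps power2_eq_square power3_eq_cube)
  then have Q0: "Q \<noteq> 0" using assms(3) by auto
  have Q_eq: "Q = - (A3^3 * u * a * b)"
    unfolding Q_def u_def a_def b_def A by algebra
  have nz: "u \<noteq> 0" "a \<noteq> 0" "b \<noteq> 0" using Q0 Q_eq by auto
  have wu: "w * u = 3 * (x1 - x2)" using nz assms(6) by (simp add: u_def)
  have au: "(1 + w) * u = 2 * a" using wu unfolding u_def a_def by algebra
  have bu: "(1 - w) * u = 2 * b" using wu unfolding u_def b_def by algebra
  have w1: "1 + w \<noteq> 0" "1 - w \<noteq> 0" using au bu nz by auto
  have Pu: "A3^2 * ((w^2 + 3) * u^2) = 12 * P"
  proof -
    have "A3^2 * ((w^2 + 3) * u^2) = A3^2 * ((w * u)^2 + 3 * u^2)" by algebra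
    also have "\<dots> = 12 * P" unfolding wu unfolding P_def u_def A by algebra
    finally show ?thesis .
  qed
  have D_eq: "27 * D * P^3 = - (Q^2)"
  proof -
    have "D = - (Q^2 / (27 * P^3))"
      using assms(5) by (simp add: P_def Q_def power2_eq_square algebra_simps)
    then show ?thesis using P0 by simp
  qed
  have sextic: "D * (w^2 + 3)^3 + 4 * (w - 1)^2 * (1 + w)^2 = 0" (is "?S = 0")
  proof -
    \<comment> \<open>Scaling by \<open>27 * A3^6 * u^6\<close> makes both terms of the sextic
      multiples of \<open>Q^2\<close>; 1728 is the cube of the 12 in \<open>Pu\<close>.\<close>
    have "A3^6 * u^6 * (w^2 + 3)^3 = (A3^2 * ((w^2 + 3) * u^2))^3"
      by (simp add: power_mult_distrib flip: power_mult)
    also have "\<dots> = 1728 * P^3" unfolding Pu by (simp add: power_mult_distrib)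
    finally have "27 * (A3^6 * u^6 * (D * (w^2 + 3)^3)) = 1728 * (27 * D * P^3)"
      by (simp add: mult_ac)
    also have "\<dots> = - 1728 * (A3^3 * u * a * b)^2" unfolding D_eq Q_eq by simp
    finally have 1: "27 * (A3^6 * u^6 * (D * (w^2 + 3)^3)) = - 1728 * (A3^3 * u * a * b)^2" .
    \<comment> \<open>The 64 is 4 times the squared factors 2 of \<open>au\<close> and
      \<open>bu\<close>; 27 * 64 = 1728 gives the cancellation.\<close>
    have "A3^6 * u^6 * (4 * (w - 1)^2 * (1 + w)^2)
        = 4 * (A3^3)^2 * u^2 * ((1 - w) * u)^2 * ((1 + w) * u)^2"
      by (simp add: power_mult_distrib power2_commute[of w] flip: power_mult power_add)
    also have "\<dots> = 64 * (A3^3 * u * a * b)^2" unfolding au bu by (simp add: power_mult_distrib)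
    finally have 2: "A3^6 * u^6 * (4 * (w - 1)^2 * (1 + w)^2) = 64 * (A3^3 * u * a * b)^2" .
    have "27 * (A3^6 * u^6 * ?S) = 0"
      unfolding distrib_left[of "A3^6 * u^6"] distrib_left[of 27] 1 2 by simp
    then show ?thesis using assms(1) nz by simp
  qed
  have Qw: "Q * (w^2 + 3) * u^2 = - 12 * P * A3 * u * a * b"
  proof -
    have "Q * (w^2 + 3) * u^2 = - A3 * u * a * b * (A3^2 * ((w^2 + 3) * u^2))"
      unfolding Q_eq by algebra
    also have "\<dots> = - 12 * P * A3 * u * a * b" unfolding Pu by algebra
    finally show ?thesis .
  qed
  \<comment> \<open>Since \<open>A2\<close> is \<open>- A3\<close> times the sum of the roots, only
    one root survives in each.\<close>
  have lin: "A3 * b + A2 = - 3 * A3 * x1" "A3 * a + A2 = - 3 * A3 * x2" "A3 * u - A2 = 3 * A3 * x3"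
    unfolding a_def b_def u_def A by algebra+
  have x1: "x1 * (18 * A3 * P * (1 + w)) = Q * w^2
      + (18 * A1 * A2 * A3 - 6 * A2^3) * w - 9 * A1 * A2 * A3 + 81 * A0 * A3^2" (is "?l = ?r")
  proof -
    have "?r = Q * (w^2 + 3) - 6 * A2 * P * (1 + w)"
      unfolding P_def Q_def by algebra
    \<comment> \<open>The factor \<open>u^2\<close> lets \<open>Qw\<close> and \<open>au\<close>
      eliminate \<open>w\<close>.\<close>
    then have "u^2 * ?r = Q * (w^2 + 3) * u^2 - 6 * A2 * P * u * ((1 + w) * u)" by algebra
    also have "\<dots> = - 12 * P * u * a * (A3 * b + A2)" unfolding Qw au by algebra
    also have "\<dots> = 18 * x1 * A3 * P * u * (2 * a)" unfolding lin by algebra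
    also have "\<dots> = u^2 * ?l" unfolding au[symmetric] by algebra
    finally show ?thesis using nz by simp
  qed
  \<comment> \<open>Mirror image of \<open>x1\<close>: swapping the two roots negates
    \<open>w\<close>, exchanges \<open>a\<close> and \<open>b\<close>, and fixes
    \<open>u\<close>.\<close>
  have x2: "x2 * (18 * A3 * P * (1 - w)) = Q * w^2
      - (18 * A1 * A2 * A3 - 6 * A2^3) * w - 9 * A1 * A2 * A3 + 81 * A0 * A3^2" (is "?l = ?r")
  proof -
    have "?r = Q * (w^2 + 3) - 6 * A2 * P * (1 - w)"
      unfolding P_def Q_def by algebra
    then have "u^2 * ?r = Q * (w^2 + 3) * u^2 - 6 * A2 * P * u * ((1 - w) * u)" by algebra
    also have "\<dots> = - 12 * P * u * b * (A3 * a + A2)" unfolding Qw bu by algebra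
    also have "\<dots> = 18 * x2 * A3 * P * u * (2 * b)" unfolding lin by algebra
    also have "\<dots> = u^2 * ?l" unfolding bu[symmetric] by algebra
    finally show ?thesis using nz by simp
  qed
  have x3: "x3 * (9 * A3 * P * (1 - w) * (1 + w)) = (A2^3 - 27 * A0 * A3^2) * w^2
      + 36 * A1 * A2 * A3 - 81 * A0 * A3^2 - 9 * A2^3" (is "?l = ?r")
  proof -
    have "?r = - (Q * (w^2 + 3)) - 3 * A2 * P * (1 - w) * (1 + w)"
      unfolding P_def Q_def by algebra
    then have "u^2 * ?r = - (Q * (w^2 + 3) * u^2) - 3 * A2 * P * ((1 - w) * u) * ((1 + w) * u)"
      by algebra
    also have "\<dots> = 12 * P * a * b * (A3 * u - A2)" unfolding Qw au bu by algebra
    also have "\<dots> = 9 * x3 * A3 * P * (2 * b) * (2 * a)" unfolding lin by algebra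
    also have "\<dots> = u^2 * ?l" unfolding au[symmetric] bu[symmetric] by algebra
    finally show ?thesis using nz by simp
  qed
  have d: "18 * A3 * P * (1 + w) \<noteq> 0" "18 * A3 * P * (1 - w) \<noteq> 0"
    "9 * A3 * P * (1 - w) * (1 + w) \<noteq> 0"
    using assms(1) P0 w1 by auto
  show ?thesis
    unfolding P_def[symmetric] Q_def[symmetric] u_def[symmetric]
    using P0 nz(1) w1 sextic x1[THEN nonzero_eq_divide_eq[OF d(1), THEN iffD2]]
      x2[THEN nonzero_eq_divide_eq[OF d(2), THEN iffD2]]
      x3[THEN nonzero_eq_divide_eq[OF d(3), THEN iffD2]]
    by blast
qed

end
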